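(* Let $\Psi\in\mathcal{H}=\mathbb{C}^N\otimes\mathbb{C}^N$ be a unit vector, let $s$ be an eigenvalue of $S=A_1+A_2$ with $p(s)=\langle\Psi,\Pi_s\Psi\rangle>0$, and let $\Psi_s=\Pi_s\Psi/\sqrt{p(s)}$. Let $a_i$ be an eigenvalue of $A$ such that $s-a_i$ is also an eigenvalue of $A$ and $\langle a_i,s-a_i|\Psi\rangle\neq 0$. Let $$\phi_{a_i}=\frac{\Pi_{a_i}\Psi_s}{\sqrt{\langle\Psi_s,\Pi_{a_i}\Psi_s\rangle}},\qquad \Pi_{a_i}=|a_i\rangle\langle a_i|\otimes I,$$ be the state after measuring first $S$ with result $s$ and then $A_1$ with result $a_i$. Then: (1) $\displaystyle \phi_{a_i}=\frac{\langle a_i,s-a_i|\Psi\rangle}{|\langle a_i,s-a_i|\Psi\rangle|}\,|a_i,s-a_i\rangle$. (2) For every function $g:\{a_1,\dots,a_N\}\to\mathbb{R}$, $\langle\phi_{a_i},g(A_2)\phi_{a_i}\rangle=g(s-a_i)$. (3) For every $j\in\{1,\dots,N\}$, $|\langle a_i,a_j|\phi_{a_i}\rangle|^2$ equals $1$ if $a_j=s-a_i$ and $0$ otherwise. (4) $\langle\phi_{a_i},A_2\phi_{a_i}\rangle=s-a_i$ and $\Delta_{\phi_{a_i}}(A_2)=0$. (5) $\langle\phi_{a_i},C_2\phi_{a_i}\rangle=0$, so that the right-hand side of the uncertainty inequality $\Delta_{\phi_{a_i}}(A_2)\,\Delta_{\phi_{a_i}}(B_2)\ge\frac12|\langle\phi_{a_i},C_2\phi_{a_i}\rangle|$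 vanishes and the vanishing of $\Delta_{\phi_{a_i}}(A_2)$ does not contradict it.
   Context: $A,B,C$ are Hermitian $N\times N$ matrices with $[A,B]=AB-BA=iC$, and $A$ has $N$ distinct eigenvalues $a_1<\dots<a_N$ with corresponding orthonormal eigenvectors $|a_1\rangle,\dots,|a_N\rangle$ of $\mathbb{C}^N$; for an eigenvalue $b$ of $A$ we write $|b\rangle$ for the corresponding eigenvector. On $\mathcal{H}=\mathbb{C}^N\otimes\mathbb{C}^N$ put $A_1=A\otimes I$, $A_2=I\otimes A$, $B_2=I\otimes B$, $C_2=I\otimes C$, $S=A_1+A_2$, and $|a_n,a_m\rangle=|a_n\rangle\otimes|a_m\rangle$. For an eigenvalue $s$ of $S$, $\Pi_s$ is the orthogonal projection onto the eigenspace of $S$ for $s$. $g(A_2)$ is defined by functional calculus, $g(A_2)|a_n,a_m\rangle=g(a_m)|a_n,a_m\rangle$. For a unit vector $\Phi\in\mathcal{H}$ and a Hermitian operator $O$ on $\mathcal{H}$, $\Delta_\Phi(O)=\sqrt{\langle\Phi,(O-\langle\Phi,O\Phi\rangle I)^2\Phi\rangle}$. *)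

theory Defs
  imports "HOL-Analysis.Analysis"
begin

text \<open>
  Hilbert space vectors are of type \<open>complex ^ 'm\<close>, operators are matrices
  \<open>complex ^ 'm ^ 'm\<close>, and the tensor product of \<open>complex ^ 'n\<close> with itself is
  \<open>complex ^ ('n \<times> 'n)\<close>.
\<close>

text \<open>Linear in the second argument; the library inner product on \<open>complex ^ 'm\<close> is its real part.\<close>

definition cinner :: "complex ^ 'm \<Rightarrow> complex ^ 'm \<Rightarrow> complex" where
  "cinner x y = (\<Sum>i\<in>UNIV. cnj (x $ i) * y $ i)"

definition hermitian :: "complex ^ 'm ^ 'm \<Rightarrow> bool" where
  "hermitian M \<longleftrightarrow> map_matrix cnj (transpose M) = M"

definition eigenspace :: "complex ^ 'm ^ 'm \<Rightarrow> complex \<Rightarrow> (complex ^ 'm) set" where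
  "eigenspace M c = {x. M *v x = c *s x}"

definition eigenvalue :: "complex ^ 'm ^ 'm \<Rightarrow> complex \<Rightarrow> bool" where
  "eigenvalue M c \<longleftrightarrow> (\<exists>x. x \<noteq> 0 \<and> M *v x = c *s x)"

definition tensor_vec :: "complex ^ 'm \<Rightarrow> complex ^ 'n \<Rightarrow> complex ^ ('m \<times> 'n)" where
  "tensor_vec x y = (\<chi> p. x $ fst p * y $ snd p)"

definition tensor_mat ::
  "complex ^ 'm ^ 'm \<Rightarrow> complex ^ 'n ^ 'n \<Rightarrow> complex ^ ('m \<times> 'n) ^ ('m \<times> 'n)" where
  "tensor_mat M K = (\<chi> p q. M $ fst p $ fst q * K $ snd p $ snd q)"

text \<open>The rank-one operator \<open>|x\<rangle>\<langle>y|\<close>.\<close>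

definition ketbra :: "complex ^ 'm \<Rightarrow> complex ^ 'm \<Rightarrow> complex ^ 'm ^ 'm" where
  "ketbra x y = (\<chi> i j. x $ i * cnj (y $ j))"

definition is_orth_proj :: "(complex ^ 'm) set \<Rightarrow> complex ^ 'm ^ 'm \<Rightarrow> bool" where
  "is_orth_proj U P \<longleftrightarrow> (\<forall>x. P *v x \<in> U \<and> (\<forall>u\<in>U. cinner u (x - P *v x) = 0))"

text \<open>For a complex subspace \<open>U\<close> the description is unique and satisfied,
  see \<open>is_orth_proj_eigenspace\<close> below.\<close>

definition orth_proj :: "(complex ^ 'm) set \<Rightarrow> complex ^ 'm ^ 'm" where
  "orth_proj U = (THE P. is_orth_proj U P)"

text \<open>Functional calculus of a Hermitian \<open>T\<close> (whose eigenvalues are all real): the spectral sum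
  of \<open>g b\<close> times the projection onto the eigenspace of \<open>b\<close>.  Lemma \<open>fun_calc_eigenvector\<close>
  gives its action on eigenvectors.\<close>

definition fun_calc :: "(real \<Rightarrow> real) \<Rightarrow> complex ^ 'm ^ 'm \<Rightarrow> complex ^ 'm ^ 'm" where
  "fun_calc g T = (\<Sum>b | eigenvalue T (of_real b).
     map_matrix ((*) (of_real (g b))) (orth_proj (eigenspace T (of_real b))))"

text \<open>For a projection \<open>P\<close> the number \<open>cinner \<Psi> (P *v \<Psi>)\<close> is real and nonnegative.\<close>

definition post_state :: "complex ^ 'm ^ 'm \<Rightarrow> complex ^ 'm \<Rightarrow> complex ^ 'm" where
  "post_state P \<Psi> = (P *v \<Psi>) /\<^sub>R sqrt (Re (cinner \<Psi> (P *v \<Psi>)))"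

text \<open>\<open>mat c\<close> is \<open>c\<close> times the identity; for Hermitian \<open>T\<close> the number under the root is real.\<close>

definition std_dev :: "complex ^ 'm \<Rightarrow> complex ^ 'm ^ 'm \<Rightarrow> real" where
  "std_dev \<Phi> T =
     (let D = T - mat (cinner \<Phi> (T *v \<Phi>)) in sqrt (Re (cinner \<Phi> ((D ** D) *v \<Phi>))))"

text \<open>\<open>|b\<rangle>\<close> for an eigenvalue \<open>b\<close>, given the enumeration \<open>a 1, \<dots>, a N\<close> of the eigenvalues and
  the corresponding eigenvectors \<open>v 1, \<dots>, v N\<close>.\<close>

definition ket :: "(nat \<Rightarrow> real) \<Rightarrow> (nat \<Rightarrow> complex ^ 'n) \<Rightarrow> real \<Rightarrow> complex ^ 'n" where
  "ket a v b = v (THE n. n \<in> {1..CARD('n)} \<and> a n = b)"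


lemma cinner_simps:
  "cinner x (y + z) = cinner x y + cinner x z"
  "cinner x (y - z) = cinner x y - cinner x z"
  "cinner (x + y) z = cinner x z + cinner y z"
  "cinner (x - y) z = cinner x z - cinner y z"
  "cinner x (c *s y) = c * cinner x y"
  "cinner (c *s x) y = cnj c * cinner x y"
  "cinner x 0 = 0" "cinner 0 x = 0"
  by (simp_all add: cinner_def algebra_simps sum.distrib sum_subtractf sum_distrib_left)

lemma Re_cinner: "Re (cinner x y) = inner x y"
  by (simp add: cinner_def inner_vec_def inner_complex_def)

lemma cinner_self_eq_0: "cinner x x = 0 \<Longrightarrow> x = 0"
  using Re_cinner[of x x] by simp

lemma cinner_commute: "cinner y x = cnj (cinner x y)"
  by (simp add: cinner_def mult.commute)

lemma cinner_hermitian: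
  assumes "hermitian M"
  shows "cinner (M *v x) y = cinner x (M *v y)"
proof -
  have h: "cnj (M $ i $ j) = M $ j $ i" for i j
  proof -
    have "map_matrix cnj (transpose M) $ j $ i = M $ j $ i"
      using assms by (simp only: hermitian_def)
    then show ?thesis
      by (simp add: transpose_def)
  qed
  have "cinner (M *v x) y = (\<Sum>i\<in>UNIV. \<Sum>j\<in>UNIV. cnj (M $ i $ j) * cnj (x $ j) * y $ i)"
    by (simp add: cinner_def matrix_vector_mult_def sum_distrib_right)
  also have "\<dots> = (\<Sum>j\<in>UNIV. \<Sum>i\<in>UNIV. cnj (M $ i $ j) * cnj (x $ j) * y $ i)"
    by (rule sum.swap)
  also have "\<dots> = cinner x (M *v y)"
    by (simp add: cinner_def matrix_vector_mult_def sum_distrib_left h mult_ac)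
  finally show ?thesis .
qed

lemma is_orth_proj_unique:
  assumes U: "\<And>x y. x \<in> U \<Longrightarrow> y \<in> U \<Longrightarrow> x - y \<in> U"
    and P: "is_orth_proj U P" and Q: "is_orth_proj U Q"
  shows "P = Q"
proof -
  have "P *v x = Q *v x" for x
  proof -
    have d: "P *v x - Q *v x \<in> U"
      using U P Q by (simp add: is_orth_proj_def)
    have "cinner (P *v x - Q *v x) (x - Q *v x) - cinner (P *v x - Q *v x) (x - P *v x) = 0"
      using d P Q by (simp add: is_orth_proj_def)
    then have "cinner (P *v x - Q *v x) (P *v x - Q *v x) = 0"
      by (simp add: cinner_simps algebra_simps)
    then show ?thesis
      using cinner_self_eq_0 by force
  qed
  then show ?thesis
    by (simp add: matrix_eq)
qed

lemma orth_proj_exists: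
  fixes U :: "(complex ^ 'm) set"
  assumes 0: "0 \<in> U" and add: "\<And>x y. x \<in> U \<Longrightarrow> y \<in> U \<Longrightarrow> x + y \<in> U"
    and sc: "\<And>c x. x \<in> U \<Longrightarrow> c *s x \<in> U"
  shows "\<exists>P. is_orth_proj U P"
proof -
  have sR: "r *\<^sub>R x = complex_of_real r *s x" for r and x :: "complex ^ 'm"
    by (simp add: vec_eq_iff scaleR_conv_of_real[where 'a = complex])
  have diff: "x - y \<in> U" if "x \<in> U" "y \<in> U" for x y
    using add[OF that(1) sc[OF that(2), of "-1"]] by (simp add: vec.scale_minus_left)
  have sub: "subspace U"
    using 0 add sc by (auto simp: subspace_def sR)
  have "\<exists>y. y \<in> U \<and> (\<forall>u\<in>U. cinner u (x - y) = 0)" for x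
  proof -
    obtain y z where yz: "y \<in> span U" "\<And>w. w \<in> span U \<Longrightarrow> orthogonal z w" "x = y + z"
      using orthogonal_subspace_decomp_exists[of U x] by blast
    have U: "span U = U"
      using sub by simp
    have "cinner u z = 0" if u: "u \<in> U" for u
    proof -
      have "inner u z = 0" "inner (\<i> *s u) z = 0"
        using yz(2)[of u] yz(2)[of "\<i> *s u"] u sc U
        by (simp_all add: orthogonal_def inner_commute[of z])
      then have "Re (cinner u z) = 0" "Re (cinner (\<i> *s u) z) = 0"
        by (simp_all add: Re_cinner)
      then show ?thesis
        by (simp add: cinner_simps complex_eq_iff)
    qed
    then show ?thesis
      using yz U by auto
  qed
  then obtain f where f: "\<And>x. f x \<in> U" "\<And>x u. u \<in> U \<Longrightarrow> cinner u (x - f x) = 0"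
    by metis
  have uniq: "f x = y" if y: "y \<in> U" "\<And>u. u \<in> U \<Longrightarrow> cinner u (x - y) = 0" for x y
  proof -
    have d: "f x - y \<in> U" using diff f(1) y(1) by blast
    have "cinner (f x - y) (x - y) - cinner (f x - y) (x - f x) = 0"
      using d f(2) y(2) by simp
    then have "cinner (f x - y) (f x - y) = 0"
      by (simp add: cinner_simps algebra_simps)
    then show ?thesis
      using cinner_self_eq_0 by force
  qed
  have "Vector_Spaces.linear (*s) (*s) f"
  proof (unfold_locales, goal_cases)
    case (1 x y)
    show ?case
      using f(2)[of _ x] f(2)[of _ y] by (intro uniq add f(1)) (simp add: cinner_simps)
  next
    case (2 c x)
    show ?case
      using f(2)[of _ x]
      by (intro uniq sc f(1)) (simp add: cinner_simps right_diff_distrib[symmetric])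
  qed
  then have "matrix f *v x = f x" for x
    by (rule matrix_works)
  then have "is_orth_proj U (matrix f)"
    using f by (simp add: is_orth_proj_def)
  then show ?thesis ..
qed

lemma is_orth_proj_eigenspace: "is_orth_proj (eigenspace M c) (orth_proj (eigenspace M c))"
proof -
  have "\<exists>P. is_orth_proj (eigenspace M c) P"
    by (rule orth_proj_exists)
      (auto simp: eigenspace_def vec.linear_add vec.scale_right_distrib
        matrix_vector_right_distrib vector_smult_assoc mult.commute vector_scalar_commute)
  moreover have "P = Q" if "is_orth_proj (eigenspace M c) P" "is_orth_proj (eigenspace M c) Q" for P Q
    using that by (rule is_orth_proj_unique[rotated])
      (auto simp: eigenspace_def matrix_vector_mult_diff_distrib vec.scale_right_diff_distrib)
  ultimately show ?thesis
    unfolding orth_proj_def by (metis (mono_tags, lifting) theI)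
qed

lemma eigenvectors_orthogonal:
  assumes "hermitian T" "T *v x = complex_of_real b *s x" "T *v y = complex_of_real c *s y" "b \<noteq> c"
  shows "cinner x y = 0"
proof -
  have "cinner (T *v x) y = cinner x (T *v y)"
    using assms(1) by (rule cinner_hermitian)
  then have "complex_of_real b * cinner x y = complex_of_real c * cinner x y"
    unfolding assms(2,3) by (simp only: cinner_simps complex_cnj_complex_of_real)
  then show ?thesis
    using assms(4) by simp
qed

lemma finite_eigenvalues:
  fixes T :: "complex ^ 'm ^ 'm"
  assumes "hermitian T"
  shows "finite {b. eigenvalue T (complex_of_real b)}" (is "finite ?E")
proof -
  have "\<forall>b. \<exists>x. b \<in> ?E \<longrightarrow> x \<noteq> 0 \<and> T *v x = complex_of_real b *s x"
    by (auto simp: eigenvalue_def)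
  then obtain w where w: "\<And>b. b \<in> ?E \<Longrightarrow> w b \<noteq> 0 \<and> T *v w b = complex_of_real b *s w b"
    by metis
  have orth: "orthogonal (w b) (w c)" if "b \<in> ?E" "c \<in> ?E" "b \<noteq> c" for b c
    using eigenvectors_orthogonal[OF assms, of "w b" b "w c" c] w that
    by (simp add: orthogonal_def flip: Re_cinner)
  have "inj_on w ?E"
  proof (rule inj_onI, rule ccontr)
    fix b c assume "b \<in> ?E" "c \<in> ?E" "w b = w c" "b \<noteq> c"
    then show False
      using orth[of b c] w[of b] by (simp add: orthogonal_def)
  qed
  moreover have "independent (w ` ?E)"
    using w orth by (intro pairwise_orthogonal_independent) (auto simp: pairwise_def)
  then have "finite (w ` ?E)"
    by (rule finiteI_independent)
  ultimately show ?thesis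
    using finite_imageD by blast
qed

lemma fun_calc_eigenvector:
  fixes T :: "complex ^ 'm ^ 'm"
  assumes T: "hermitian T" and x: "T *v x = complex_of_real b *s x"
  shows "fun_calc g T *v x = complex_of_real (g b) *s x"
proof (cases "x = 0")
  case False
  let ?E = "{b. eigenvalue T (complex_of_real b)}"
  let ?P = "\<lambda>c. orth_proj (eigenspace T (complex_of_real c))"
  have P: "?P c *v x = (if c = b then x else 0)" for c
  proof -
    have y: "?P c *v x \<in> eigenspace T (complex_of_real c)"
      and o: "\<And>u. u \<in> eigenspace T (complex_of_real c) \<Longrightarrow> cinner u (x - ?P c *v x) = 0"
      using is_orth_proj_eigenspace[of T "complex_of_real c"] by (auto simp: is_orth_proj_def)
    show ?thesis
    proof (cases "c = b")
      case True
      have "x - ?P c *v x \<in> eigenspace T (complex_of_real c)"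
        using y x True
        by (simp add: eigenspace_def matrix_vector_mult_diff_distrib vec.scale_right_diff_distrib)
      then have "x - ?P c *v x = 0"
        using o cinner_self_eq_0 by blast
      then show ?thesis using True by simp
    next
      case False
      have "cinner (?P c *v x) x = 0"
        using eigenvectors_orthogonal[OF T _ x False] y by (simp add: eigenspace_def)
      then have "cinner (?P c *v x) (?P c *v x) = 0"
        using o[OF y] by (simp add: cinner_simps)
      then show ?thesis using False cinner_self_eq_0 by simp
    qed
  qed
  have m: "map_matrix ((*) k) M *v y = k *s (M *v y)" for k and M :: "complex ^ 'm ^ 'm" and y
    by (simp add: vec_eq_iff matrix_vector_mult_def sum_distrib_left mult.assoc)
  have s: "sum F X *v x = (\<Sum>c\<in>X. F c *v x)" if "finite X" for F :: "real \<Rightarrow> complex ^ 'm ^ 'm" and X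
    using that by induction (auto simp: matrix_vector_mult_add_rdistrib)
  have "fun_calc g T *v x = (\<Sum>c\<in>?E. if c = b then complex_of_real (g b) *s x else 0)"
    unfolding fun_calc_def s[OF finite_eigenvalues[OF T]] by (intro sum.cong) (auto simp: m P)
  also have "\<dots> = complex_of_real (g b) *s x"
    using finite_eigenvalues[OF T] x False by (auto simp: eigenvalue_def)
  finally show ?thesis .
next
  case True
  then show ?thesis
    by (simp only: matrix_vector_mult_0_right vec.scale_zero_right)
qed

end

theory Submission
  imports Defs
begin

text \<open>
  Since \<open>A\<close> has simple spectrum, \<open>|a\<^sub>i, s - a\<^sub>i\<rangle>\<close> is, up to scalars, the only
  vector of the form \<open>|a\<^sub>i\<rangle> \<otimes> z\<close> in the eigenspace of \<open>S\<close> for \<open>s\<close>.  Measuring \<open>S\<close> and then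
  \<open>A\<^sub>1\<close> therefore leaves this product vector up to a phase.  It is an eigenvector of \<open>A\<^sub>2\<close>, and the
  expectation of a commutator \<open>[A, B]\<close> in an eigenvector of \<open>A\<close> vanishes.
\<close>

section \<open>Hermitian matrices, scalars and tensor products\<close>

lemma hermitian_iff: "hermitian M \<longleftrightarrow> (\<forall>i j. cnj (M $ i $ j) = M $ j $ i)"
  by (auto simp: hermitian_def vec_eq_iff transpose_def)

lemma hermitian_mat_1: "hermitian (mat 1)"
  by (simp add: hermitian_iff mat_def)

lemma hermitian_add: "hermitian M \<Longrightarrow> hermitian K \<Longrightarrow> hermitian (M + K)"
  by (simp add: hermitian_iff)

lemma hermitian_tensor_mat: "hermitian M \<Longrightarrow> hermitian K \<Longrightarrow> hermitian (tensor_mat M K)"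
  by (simp add: hermitian_iff tensor_mat_def)

lemma cinner_sum_right: "cinner x (\<Sum>i\<in>I. f i) = (\<Sum>i\<in>I. cinner x (f i))"
  by (induction I rule: infinite_finite_induct) (simp_all add: cinner_simps)

lemma map_matrix_mult_vec: "map_matrix ((*) k) M *v x = k *s (M *v x)"
  for M :: "complex ^ 'm ^ 'm"
  by (simp add: vec_eq_iff matrix_vector_mult_def sum_distrib_left mult.assoc)

lemma mat_mult_vec: "mat c *v x = c *s x"
  for x :: "complex ^ 'm"
  by (simp add: vec_eq_iff matrix_vector_mult_def mat_def if_distrib[of "\<lambda>z. z * w" for w]
      cong: if_cong)

lemma sum_UNIV_prod:
  fixes f :: "'a::finite \<times> 'b::finite \<Rightarrow> 'c::comm_monoid_add"
  shows "(\<Sum>p\<in>UNIV. f p) = (\<Sum>i\<in>UNIV. \<Sum>j\<in>UNIV. f (i, j))"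
  by (simp add: sum.cartesian_product flip: UNIV_Times_UNIV)

lemma cinner_tensor_vec:
  "cinner (tensor_vec x y) (tensor_vec x' y') = cinner x x' * cinner y y'"
  by (simp add: cinner_def tensor_vec_def sum_UNIV_prod sum_product mult_ac)

lemma tensor_mat_mult_tensor_vec:
  "tensor_mat M K *v tensor_vec x y = tensor_vec (M *v x) (K *v y)"
  by (simp add: vec_eq_iff matrix_vector_mult_def tensor_mat_def tensor_vec_def sum_UNIV_prod
      sum_product mult_ac)

lemma tensor_vec_scale_left: "tensor_vec (c *s x) y = c *s tensor_vec x y"
  by (simp add: vec_eq_iff tensor_vec_def)

lemma tensor_vec_scale_right: "tensor_vec x (c *s y) = c *s tensor_vec x y"
  by (simp add: vec_eq_iff tensor_vec_def)

text \<open>The partial inner product \<open>(\<langle>x| \<otimes> I) \<Phi>\<close>.\<close>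

definition partial_cinner :: "complex ^ 'm \<Rightarrow> complex ^ ('m \<times> 'n) \<Rightarrow> complex ^ 'n" where
  "partial_cinner x \<Phi> = (\<chi> j. \<Sum>k\<in>UNIV. cnj (x $ k) * \<Phi> $ (k, j))"

text \<open>Adjointness: coefficients of a partial inner product become overlaps with product
  vectors, to which the spectral theory of \<open>S\<close> applies.\<close>

lemma cinner_partial_cinner: "cinner y (partial_cinner x \<Phi>) = cinner (tensor_vec x y) \<Phi>"
proof -
  have "cinner y (partial_cinner x \<Phi>)
      = (\<Sum>j\<in>UNIV. \<Sum>k\<in>UNIV. cnj (y $ j) * (cnj (x $ k) * \<Phi> $ (k, j)))"
    by (simp add: cinner_def partial_cinner_def sum_distrib_left)
  also have "\<dots> = (\<Sum>k\<in>UNIV. \<Sum>j\<in>UNIV. cnj (y $ j) * (cnj (x $ k) * \<Phi> $ (k, j)))"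
    by (rule sum.swap)
  also have "\<dots> = cinner (tensor_vec x y) \<Phi>"
    by (simp add: cinner_def tensor_vec_def sum_UNIV_prod mult_ac)
  finally show ?thesis .
qed

text \<open>Measuring the first factor leaves a product vector, so only its second factor remains to
  be found.\<close>

lemma tensor_ketbra_mult_vec:
  "tensor_mat (ketbra x x) (mat 1) *v \<Phi> = tensor_vec x (partial_cinner x \<Phi>)"
proof -
  have "(tensor_mat (ketbra x x) (mat 1) *v \<Phi>) $ (i, j)
      = tensor_vec x (partial_cinner x \<Phi>) $ (i, j)" for i j
  proof -
    have "(tensor_mat (ketbra x x) (mat 1) *v \<Phi>) $ (i, j)
        = (\<Sum>k\<in>UNIV. \<Sum>l\<in>UNIV. if j = l then x $ i * cnj (x $ k) * \<Phi> $ (k, l) else 0)"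
      unfolding matrix_vector_mult_def tensor_mat_def ketbra_def mat_def sum_UNIV_prod vec_lambda_beta
      by (intro sum.cong refl) simp
    also have "\<dots> = tensor_vec x (partial_cinner x \<Phi>) $ (i, j)"
      by (simp add: tensor_vec_def partial_cinner_def sum_distrib_left mult.assoc)
    finally show ?thesis .
  qed
  then show ?thesis
    by (simp add: vec_eq_iff split_paired_all)
qed

section \<open>Expansion in an orthonormal eigenbasis\<close>

text \<open>Orthonormality says that one square matrix is a left inverse of another; it is then also
  a right inverse, which is completeness.\<close>

lemma orthonormal_expansion:
  fixes v :: "'i \<Rightarrow> complex ^ 'n"
  assumes I: "finite I" "card I = CARD('n)"
    and on: "\<And>n m. n \<in> I \<Longrightarrow> m \<in> I \<Longrightarrow> cinner (v n) (v m) = (if n = m then 1 else 0)"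
  shows "x = (\<Sum>n\<in>I. cinner (v n) x *s v n)"
proof -
  \<comment> \<open>Reindexing the family by \<open>'n\<close> makes the matrices of its vectors
    square.\<close>
  obtain h where h: "bij_betw h (UNIV :: 'n set) I"
    using I finite_same_card_bij by (metis finite_class.finite_UNIV)
  define W :: "complex ^ 'n ^ 'n" where "W = (\<chi> k l. cnj (v (h k) $ l))"
  define V :: "complex ^ 'n ^ 'n" where "V = (\<chi> l k. v (h k) $ l)"
  have "(W ** V) $ k $ l = mat 1 $ k $ l" for k l
  proof -
    have "(W ** V) $ k $ l = cinner (v (h k)) (v (h l))"
      by (simp add: W_def V_def matrix_matrix_mult_def cinner_def)
    also have "\<dots> = mat 1 $ k $ l"
      using h on[of "h k" "h l"] by (auto simp: mat_def bij_betw_def inj_on_def)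
    finally show ?thesis .
  qed
  then have "W ** V = mat 1"
    by (simp add: vec_eq_iff)
  then have "V ** W = mat 1"
    by (simp add: matrix_left_right_inverse)
  then have "x = V *v (W *v x)"
    by (simp add: matrix_vector_mul_assoc)
  also have "\<dots> = (\<Sum>k\<in>UNIV. cinner (v (h k)) x *s v (h k))"
    by (simp add: vec_eq_iff W_def V_def matrix_vector_mult_def cinner_def mult.commute)
  also have "\<dots> = (\<Sum>n\<in>I. cinner (v n) x *s v n)"
    by (rule sum.reindex_bij_betw[OF h])
  finally show ?thesis .
qed

text \<open>An eigenvector for any other eigenvalue would be orthogonal to the whole basis and hence
  zero.\<close>

lemma ex_orthonormal_eigenbasis_eigenvalue:
  fixes v :: "'i \<Rightarrow> complex ^ 'n"
  assumes T: "hermitian T" and I: "finite I" "card I = CARD('n)"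
    and ev: "\<And>n. n \<in> I \<Longrightarrow> T *v v n = of_real (a n) *s v n"
    and on: "\<And>n m. n \<in> I \<Longrightarrow> m \<in> I \<Longrightarrow> cinner (v n) (v m) = (if n = m then 1 else 0)"
    and b: "eigenvalue T (of_real b)"
  shows "\<exists>m\<in>I. a m = b"
proof -
  obtain x where x: "x \<noteq> 0" "T *v x = of_real b *s x"
    using b by (auto simp: eigenvalue_def)
  show ?thesis
  proof (rule ccontr)
    assume "\<not> ?thesis"
    then have "cinner (v n) x = 0" if "n \<in> I" for n
      using eigenvectors_orthogonal[OF T ev[OF that] x(2)] that by blast
    moreover have "x = (\<Sum>n\<in>I. cinner (v n) x *s v n)"
      using I on by (rule orthonormal_expansion)
    ultimately have "x = 0"
      by simp
    with x show False by simp
  qed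
qed

section \<open>Measured states and expectations in eigenvectors\<close>

text \<open>The normalizing factor is the modulus of \<open>cinner e x\<close>, so only the phase
  survives. If the overlap is 0, both sides are 0, since division by 0 gives 0.\<close>

lemma post_state_rank_one:
  assumes "P *v x = cinner e x *s e"
  shows "post_state P x = (cinner e x / of_real (cmod (cinner e x))) *s e"
proof -
  have "cinner x (P *v x) = of_real ((cmod (cinner e x))\<^sup>2)"
    by (simp add: assms cinner_simps cinner_commute[of e x] complex_norm_square
        del: of_real_power)
  then show ?thesis
    by (simp add: post_state_def assms vec_eq_iff scaleR_conv_of_real[where 'a = complex] field_simps)
qed

text \<open>The mean of \<open>T\<close> in \<open>x\<close> is \<open>c\<close>, and
  \<open>T - mat c\<close> annihilates \<open>x\<close>.\<close>

lemma std_dev_eigenvector: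
  assumes "cinner x x = 1" "T *v x = c *s x"
  shows "std_dev x T = 0"
proof -
  have "(T - mat c) *v x = 0"
    by (simp add: assms(2) matrix_vector_mult_diff_rdistrib mat_mult_vec)
  moreover have "cinner x (T *v x) = c"
    by (simp add: assms cinner_simps)
  ultimately show ?thesis
    by (simp add: std_dev_def Let_def cinner_simps flip: matrix_vector_mul_assoc)
qed

text \<open>Moving \<open>A\<close> onto the eigenvector, on the left by hermiticity, turns both
  products into the same multiple of \<open>cinner x (B *v x)\<close>, as \<open>b\<close> is
  real.\<close>

lemma cinner_commutator_eigenvector:
  assumes A: "hermitian A" and x: "A *v x = of_real b *s x"
  shows "cinner x ((A ** B - B ** A) *v x) = 0"
proof -
  have "cinner x (A *v (B *v x)) = of_real b * cinner x (B *v x)"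
    by (simp add: x cinner_simps flip: cinner_hermitian[OF A])
  moreover have "cinner x (B *v (A *v x)) = of_real b * cinner x (B *v x)"
    by (simp add: x cinner_simps vector_scalar_commute)
  ultimately show ?thesis
    by (simp add: matrix_vector_mult_diff_rdistrib cinner_simps flip: matrix_vector_mul_assoc)
qed

theorem mainTheorem4:
  fixes A B C :: "complex ^ 'n ^ 'n"
    and a :: "nat \<Rightarrow> real" and v :: "nat \<Rightarrow> complex ^ 'n"
    and \<Psi> :: "complex ^ ('n \<times> 'n)" and s :: real and i :: nat
  defines "A\<^sub>1 \<equiv> tensor_mat A (mat 1 :: complex ^ 'n ^ 'n)"
    and "A\<^sub>2 \<equiv> tensor_mat (mat 1 :: complex ^ 'n ^ 'n) A"
    and "B\<^sub>2 \<equiv> tensor_mat (mat 1 :: complex ^ 'n ^ 'n) B"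
    and "C\<^sub>2 \<equiv> tensor_mat (mat 1 :: complex ^ 'n ^ 'n) C"
  defines "S \<equiv> A\<^sub>1 + A\<^sub>2"
  defines "\<Pi>\<^sub>s \<equiv> orth_proj (eigenspace S (of_real s))"
  defines "\<Psi>\<^sub>s \<equiv> post_state \<Pi>\<^sub>s \<Psi>"
  defines "\<phi> \<equiv> post_state (tensor_mat (ketbra (v i) (v i)) (mat 1 :: complex ^ 'n ^ 'n)) \<Psi>\<^sub>s"
  defines "e \<equiv> tensor_vec (v i) (ket a v (s - a i))"
  assumes "hermitian A" and "hermitian B" and "hermitian C"
    and "A ** B - B ** A = map_matrix ((*) \<i>) C"
    and "strict_mono_on {1..CARD('n)} a"
    and "\<And>n. n \<in> {1..CARD('n)} \<Longrightarrow> A *v v n = of_real (a n) *s v n"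
    and "\<And>n m. n \<in> {1..CARD('n)} \<Longrightarrow> m \<in> {1..CARD('n)} \<Longrightarrow>
           cinner (v n) (v m) = (if n = m then 1 else 0)"
    and "cinner \<Psi> \<Psi> = 1"
    and "eigenvalue S (of_real s)"
    and "Re (cinner \<Psi> (\<Pi>\<^sub>s *v \<Psi>)) > 0"
    and "i \<in> {1..CARD('n)}"
    and "eigenvalue A (of_real (s - a i))"
    and "cinner e \<Psi> \<noteq> 0"
  shows "\<phi> = (cinner e \<Psi> / of_real (cmod (cinner e \<Psi>))) *s e \<and>
    (\<forall>g :: real \<Rightarrow> real. cinner \<phi> (fun_calc g A\<^sub>2 *v \<phi>) = of_real (g (s - a i))) \<and>
    (\<forall>j \<in> {1..CARD('n)}.
       (cmod (cinner (tensor_vec (v i) (v j)) \<phi>))\<^sup>2 = (if a j = s - a i then 1 else 0)) \<and>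
    (cinner \<phi> (A\<^sub>2 *v \<phi>) = of_real (s - a i) \<and> std_dev \<phi> A\<^sub>2 = 0) \<and>
    (cinner \<phi> (C\<^sub>2 *v \<phi>) = 0 \<and>
     1 / 2 * cmod (cinner \<phi> (C\<^sub>2 *v \<phi>)) = 0 \<and>
     std_dev \<phi> A\<^sub>2 * std_dev \<phi> B\<^sub>2 \<ge> 1 / 2 * cmod (cinner \<phi> (C\<^sub>2 *v \<phi>)))"
proof -
  note hA = assms(10) and comm = assms(13) and mono = assms(14) and ev = assms(15)
    and on = assms(16) and i = assms(20)
  let ?I = "{1..CARD('n)}"
  have card: "finite ?I" "card ?I = CARD('n)"
    by simp_all
  have inj: "inj_on a ?I"
    using mono by (rule strict_mono_on_imp_inj_on)
  have "\<exists>m\<in>?I. a m = s - a i"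
    using hA card ev on assms(21) by (rule ex_orthonormal_eigenbasis_eigenvalue)
  then obtain m where m: "m \<in> ?I" "a m = s - a i"
    by blast
  have am: "a n = s - a i \<longleftrightarrow> n = m" if "n \<in> ?I" for n
    unfolding m(2)[symmetric] using inj that m(1) by (rule inj_on_eq_iff)
  \<comment> \<open>The eigenvalues are distinct, so the description inside \<open>ket\<close>
    selects \<open>m\<close>.\<close>
  have "(THE n. n \<in> ?I \<and> a n = s - a i) = m"
    using m am by blast
  then have e: "e = tensor_vec (v i) (v m)"
    by (simp add: e_def ket_def)
  have ee: "cinner e e = 1"
    using on[OF i i] on[OF m(1) m(1)] by (simp add: e cinner_tensor_vec)
  have hS: "hermitian S" and hA2: "hermitian A\<^sub>2"
    unfolding S_def A\<^sub>1_def A\<^sub>2_def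
    by (intro hermitian_add hermitian_tensor_mat hermitian_mat_1 hA)+
  have A2: "A\<^sub>2 *v tensor_vec x (v n) = of_real (a n) *s tensor_vec x (v n)" if "n \<in> ?I" for n x
    using ev[OF that] by (simp add: A\<^sub>2_def tensor_mat_mult_tensor_vec tensor_vec_scale_right)
  have S: "S *v tensor_vec (v i) (v n) = of_real (a i + a n) *s tensor_vec (v i) (v n)"
    if "n \<in> ?I" for n
    using ev[OF i] A2[OF that]
    by (simp add: S_def A\<^sub>1_def tensor_mat_mult_tensor_vec tensor_vec_scale_left
        matrix_vector_mult_add_rdistrib vec.scale_left_distrib)
  have Se: "e \<in> eigenspace S (of_real s)"
    using S[OF m(1)] m(2) by (simp add: eigenspace_def e)

  define p where "p = Re (cinner \<Psi> (\<Pi>\<^sub>s *v \<Psi>))"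
  have p: "p > 0"
    using assms(19) by (simp add: p_def)
  have proj: "is_orth_proj (eigenspace S (of_real s)) \<Pi>\<^sub>s"
    unfolding \<Pi>\<^sub>s_def by (rule is_orth_proj_eigenspace)
  have \<Psi>s: "\<Psi>\<^sub>s = of_real (1 / sqrt p) *s (\<Pi>\<^sub>s *v \<Psi>)"
    by (simp add: \<Psi>\<^sub>s_def post_state_def p_def vec_eq_iff scaleR_conv_of_real[where 'a = complex]
        divide_inverse)
  have S\<Psi>: "S *v \<Psi>\<^sub>s = of_real s *s \<Psi>\<^sub>s"
    using proj
    by (simp add: \<Psi>s is_orth_proj_def eigenspace_def vector_scalar_commute vector_smult_assoc
        mult.commute)
  \<comment> \<open>As \<open>e\<close> lies in the eigenspace, projecting leaves its overlap with
    the state unchanged; only the normalization enters.\<close>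
  have "cinner e (\<Psi> - \<Pi>\<^sub>s *v \<Psi>) = 0"
    using proj Se by (simp add: is_orth_proj_def)
  then have e\<Psi>: "cinner e \<Psi>\<^sub>s = of_real (1 / sqrt p) * cinner e \<Psi>"
    by (simp add: \<Psi>s cinner_simps)

  let ?z = "partial_cinner (v i) \<Psi>\<^sub>s"
  \<comment> \<open>For \<open>n\<close> other than \<open>m\<close>, the product of
    \<open>v i\<close> and \<open>v n\<close> belongs to an eigenvalue of \<open>S\<close> different
    from \<open>s\<close>, hence is orthogonal to \<open>\<Psi>\<^sub>s\<close>.\<close>
  have "cinner (v n) ?z = 0" if n: "n \<in> ?I" "n \<noteq> m" for n
  proof -
    have "a i + a n \<noteq> s"
      using am[OF n(1)] n(2) by linarith
    then show ?thesis
      unfolding cinner_partial_cinner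
      using eigenvectors_orthogonal[OF hS S[OF n(1)] S\<Psi>] by simp
  qed
  then have "(\<Sum>n\<in>?I. cinner (v n) ?z *s v n) = (\<Sum>n\<in>{m}. cinner (v n) ?z *s v n)"
    using m(1) by (intro sum.mono_neutral_right) auto
  moreover have "?z = (\<Sum>n\<in>?I. cinner (v n) ?z *s v n)"
    by (rule orthonormal_expansion[OF card on])
  ultimately have z: "?z = cinner e \<Psi>\<^sub>s *s v m"
    by (simp add: cinner_partial_cinner e)
  have "tensor_mat (ketbra (v i) (v i)) (mat 1) *v \<Psi>\<^sub>s = cinner e \<Psi>\<^sub>s *s e"
    by (simp add: tensor_ketbra_mult_vec z tensor_vec_scale_right e)
  then have "\<phi> = (cinner e \<Psi>\<^sub>s / of_real (cmod (cinner e \<Psi>\<^sub>s))) *s e"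
    unfolding \<phi>_def by (rule post_state_rank_one)
  \<comment> \<open>The positive factor \<open>1 / sqrt p\<close> does not affect the phase.\<close>
  also have "cinner e \<Psi>\<^sub>s / of_real (cmod (cinner e \<Psi>\<^sub>s))
      = cinner e \<Psi> / of_real (cmod (cinner e \<Psi>))"
    using p by (simp add: e\<Psi> norm_mult norm_divide)
  finally have \<phi>: "\<phi> = (cinner e \<Psi> / of_real (cmod (cinner e \<Psi>))) *s e" .

  \<comment> \<open>The phase; its modulus is 1 because the overlap is nonzero.\<close>
  define u where "u = cinner e \<Psi> / of_real (cmod (cinner e \<Psi>))"
  have \<phi>u: "\<phi> = u *s e"
    by (simp add: \<phi> u_def)
  have u1: "cmod u = 1"
    using assms(22) by (simp add: u_def norm_divide)
  then have uu: "u * cnj u = 1"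
    using complex_norm_square[of u] by simp
  have \<phi>1: "cinner \<phi> \<phi> = 1"
    using uu by (simp add: \<phi>u cinner_simps ee mult.commute)
  have A2\<phi>: "A\<^sub>2 *v \<phi> = of_real (s - a i) *s \<phi>"
    unfolding m(2)[symmetric] using A2[OF m(1)]
    by (simp add: \<phi>u e vector_scalar_commute vector_smult_assoc mult.commute)
  have 2: "cinner \<phi> (fun_calc g A\<^sub>2 *v \<phi>) = of_real (g (s - a i))" for g
    by (simp add: fun_calc_eigenvector[OF hA2 A2\<phi>] cinner_simps \<phi>1)
  have 3: "(cmod (cinner (tensor_vec (v i) (v j)) \<phi>))\<^sup>2 = (if a j = s - a i then 1 else 0)"
    if j: "j \<in> ?I" for j
    unfolding am[OF j] using on[OF i i] on[OF j m(1)]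
    by (simp add: \<phi>u e cinner_simps cinner_tensor_vec norm_mult u1)
  have 4: "cinner \<phi> (A\<^sub>2 *v \<phi>) = of_real (s - a i)" "std_dev \<phi> A\<^sub>2 = 0"
    by (simp only: A2\<phi> cinner_simps \<phi>1 mult_1_right)
      (rule std_dev_eigenvector[OF \<phi>1 A2\<phi>])
  \<comment> \<open>The expectation of the commutator is \<open>\<i>\<close> times that of
    \<open>C\<close>, so both vanish.\<close>
  have "cinner (v m) (C *v v m) = 0"
    using cinner_commutator_eigenvector[OF hA ev[OF m(1)], of B]
    by (simp add: comm map_matrix_mult_vec cinner_simps)
  then have 5: "cinner \<phi> (C\<^sub>2 *v \<phi>) = 0"
    by (simp add: \<phi>u e C\<^sub>2_def vector_scalar_commute cinner_simps tensor_mat_mult_tensor_vec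
        cinner_tensor_vec)
  \<comment> \<open>Both sides of the uncertainty inequality are 0, whatever the deviation of
    \<open>B\<^sub>2\<close>.\<close>
  show ?thesis
    using \<phi> 2 3 4 5 by simp
qed

end
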